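(* Suppose that $\kappa$ and $\lambda$ are infinite cardinals such that for each coloring $c\colon[\kappa]^{<\omega}\to\{0,1\}$ there are subsets $K_0,K_1\subset\kappa$, $|K_0|=\aleph_0$, $|K_1|=\lambda$, such that at least one of the following conditions holds: (i) the set $\{M\in[K_1]^{<\omega}: c(M)=1\}$ is cofinal in $[K_1]^{<\omega}$ ordered by inclusion (every finite $L\subset K_1$ is contained in some finite $M\subset K_1$ with $c(M)=1$); (ii) there exists $1<n<\omega$ such that $c([K_0]^n)=\{0\}$. Then for every $\varepsilon>0$, each normalized weakly null sequence $\{x_\alpha\}_{\alpha<\kappa}$ of a real Banach space contains a $(1+\varepsilon)$-suppression unconditional subsequence of length $\lambda$.
   Context: Notation: $[S]^n$ is the set of $n$-element subsets of $S$ and $[S]^{<\omega}$ is the set of finite subsets of $S$. A sequence $\{x_\alpha\}_{\alpha<\kappa}\subset X$ is weakly null if for all $f\in X^*$ and $\delta>0$ the set $\{\alpha<\kappa:|f(x_\alpha)|>\delta\}$ is finite. Normalized means $\|x_\alpha\|=1$ for all $\alpha$. A subsequence of length $\lambda$ is $\{x_{\alpha_\sigma}\}_{\sigma<\lambda}$ with $\sigma\mapsto\alpha_\sigma$ strictly increasing. A normalized sequence $\{e_\alpha\}_{\alpha<\lambda}$ is $C$-suppression unconditional ($C\ge1$) if $\|\sum_{\alpha\in A}c_\alpha e_\alpha\|\le C\|\sum_{\alpha\in B}c_\alpha e_\alpha\|$ for all finite $A\subset B\subset\lambda$ and all $c_\alpha\in\mathbb{R}$, $\alpha\in B$. *)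

theory Defs
  imports "HOL-Analysis.Analysis" "HOL-Library.Ramsey"
begin

unbundle cardinal_syntax

text \<open>
  A cardinal is a \<^const>\<open>Card_order\<close>, that is, a well-order \<open>r\<close> of least possible length on its
  field; the ordinals below it are the elements of \<^term>\<open>Field r\<close>. The relation is reflexive, so
  strict comparison is membership in \<open>r - Id\<close>. A sequence of length \<open>r\<close> is a function
  considered on \<^term>\<open>Field r\<close> only. The collection of finite subsets of \<open>S\<close> is \<^term>\<open>Fpow S\<close>,
  and that of \<open>n\<close>-element subsets is \<^term>\<open>nsets S n\<close>.
\<close>

definition normalized_on :: "'i set \<Rightarrow> ('i \<Rightarrow> 'x::real_normed_vector) \<Rightarrow> bool" where
  "normalized_on I x \<longleftrightarrow> (\<forall>\<alpha>\<in>I. norm (x \<alpha>) = 1)"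

definition weakly_null_on :: "'i set \<Rightarrow> ('i \<Rightarrow> 'x::real_normed_vector) \<Rightarrow> bool" where
  "weakly_null_on I x \<longleftrightarrow>
     (\<forall>f :: 'x \<Rightarrow>\<^sub>L real. \<forall>\<delta>>0. finite {\<alpha>\<in>I. \<bar>blinfun_apply f (x \<alpha>)\<bar> > \<delta>})"

definition suppression_unconditional_on ::
    "real \<Rightarrow> 'i set \<Rightarrow> ('i \<Rightarrow> 'x::real_normed_vector) \<Rightarrow> bool" where
  "suppression_unconditional_on C I e \<longleftrightarrow>
     1 \<le> C \<and> normalized_on I e \<and>
     (\<forall>A B. \<forall>c :: 'i \<Rightarrow> real. finite B \<and> A \<subseteq> B \<and> B \<subseteq> I \<longrightarrow>
        norm (\<Sum>\<alpha>\<in>A. c \<alpha> *\<^sub>R e \<alpha>) \<le> C * norm (\<Sum>\<alpha>\<in>B. c \<alpha> *\<^sub>R e \<alpha>))"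

definition strictly_increasing_between :: "'l rel \<Rightarrow> 'k rel \<Rightarrow> ('l \<Rightarrow> 'k) \<Rightarrow> bool" where
  "strictly_increasing_between s r g \<longleftrightarrow>
     g \<in> Field s \<rightarrow> Field r \<and>
     monotone_on (Field s) (\<lambda>\<sigma> \<tau>. (\<sigma>, \<tau>) \<in> s - Id) (\<lambda>\<alpha> \<beta>. (\<alpha>, \<beta>) \<in> r - Id) g"

definition cofinal_subfamily :: "'a set set \<Rightarrow> 'a set set \<Rightarrow> bool" where
  "cofinal_subfamily \<C> \<F> \<longleftrightarrow> \<C> \<subseteq> \<F> \<and> (\<forall>L\<in>\<F>. \<exists>M\<in>\<C>. L \<subseteq> M)"

end

theory Submission
  imports Defs
begin

text \<open>
  Colour a finite set of indices by whether the corresponding finite sequence is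
  \<open>(1 + \<epsilon>)\<close>-suppression unconditional. This property passes to subsets, so alternative (i) makes
  \<open>K\<^sub>1\<close> suppression unconditional, and an order embedding of \<open>\<Lambda>\<close> into \<open>K\<^sub>1\<close> does the rest.
  Alternative (ii) is impossible: by Ramsey's theorem a normalized weakly null sequence has a
  subsequence on which the norm of an \<open>n\<close>-term combination hardly depends on the positions used
  (an approximate spreading model), while by Mazur's theorem there are arbitrarily late convex
  combinations of small norm. Averaging unwanted terms over such blocks deletes them, so some
  \<open>n\<close>-element subset is suppression unconditional.
\<close>

section \<open>Sublinear functionals and the Hahn-Banach theorem\<close>

definition sublinear :: "('a::real_vector \<Rightarrow> real) \<Rightarrow> bool" where
  "sublinear q \<longleftrightarrow> (\<forall>x y. q (x + y) \<le> q x + q y) \<and> (\<forall>t\<ge>0. \<forall>x. q (t *\<^sub>R x) = t * q x)"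

text \<open>For functionals defined by infima only upper bounds are immediate. Scaling back by
  \<open>inverse t\<close> reverses the bound. Subadditivity gives \<open>0 \<le> q 0\<close> and
  the factor \<open>1/2\<close> gives \<open>q 0 \<le> q 0 / 2\<close>, so
  \<open>q 0 = 0\<close>.\<close>

lemma sublinearI:
  assumes add: "\<And>x y. q (x + y) \<le> q x + q y"
    and scale: "\<And>t x. t > 0 \<Longrightarrow> q (t *\<^sub>R x) \<le> t * q x"
  shows "sublinear q"
proof -
  have "q 0 = 0"
    using add[of 0 0] scale[of "1/2" 0] by simp
  moreover have "q (t *\<^sub>R x) = t * q x" if "t > 0" for t x
  proof (rule antisym)
    have "q x \<le> inverse t * q (t *\<^sub>R x)"
      using scale[of "inverse t" "t *\<^sub>R x"] that by simp
    then show "t * q x \<le> q (t *\<^sub>R x)"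
      using that by (simp add: field_simps)
  qed (use scale that in auto)
  ultimately have "q (t *\<^sub>R x) = t * q x" if "t \<ge> 0" for t x
    using that by (cases "t = 0") auto
  with add show ?thesis
    by (simp add: sublinear_def)
qed

lemma sublinear_add: "sublinear q \<Longrightarrow> q (x + y) \<le> q x + q y"
  by (simp add: sublinear_def)

lemma sublinear_scaleR: "sublinear q \<Longrightarrow> t \<ge> 0 \<Longrightarrow> q (t *\<^sub>R x) = t * q x"
  by (simp add: sublinear_def)

lemma sublinear_minus: "sublinear q \<Longrightarrow> - q (- x) \<le> q x"
  using sublinear_add[of q x "- x"] sublinear_scaleR[of q 0 x] by simp

lemma sublinear_norm: "sublinear norm"
  by (simp add: sublinear_def norm_triangle_ineq)

text \<open>Reduces subadditivity of a functional defined by infima to a bound for each pair of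
  competitors; the two infima are taken one after the other.\<close>

lemma le_cINF_add:
  fixes c :: real
  assumes "A \<noteq> {}" "B \<noteq> {}" and le: "\<And>i j. i \<in> A \<Longrightarrow> j \<in> B \<Longrightarrow> c \<le> f i + g j"
  shows "c \<le> (INF i\<in>A. f i) + (INF j\<in>B. g j)"
proof -
  have "c - f i \<le> (INF j\<in>B. g j)" if "i \<in> A" for i
    using assms that by (intro cINF_greatest) (auto simp: algebra_simps)
  then have "c - (INF j\<in>B. g j) \<le> (INF i\<in>A. f i)"
    using assms by (intro cINF_greatest) (auto simp: algebra_simps)
  then show ?thesis
    by simp
qed

text \<open>Take the infimum of \<open>q (x + t *\<^sub>R k) - t * b\<close> over
  \<open>t \<ge> 0\<close> and \<open>k \<in> K\<close>. The choice \<open>t = 0\<close> gives the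
  bound by \<open>q\<close>, \<open>t = 1\<close> at \<open>- k\<close> gives \<open>- b\<close>,
  and convexity of \<open>K\<close> lets two competitors merge, which is subadditivity. A linear
  functional below the result is at least \<open>b\<close> on \<open>K\<close>.\<close>

lemma sublinear_tilt:
  fixes q :: "'a::real_vector \<Rightarrow> real"
  assumes q: "sublinear q" and K: "convex K" "K \<noteq> {}" and b: "\<And>k. k \<in> K \<Longrightarrow> b \<le> q k"
  obtains q' where "sublinear q'" "\<And>x. q' x \<le> q x" "\<And>k. k \<in> K \<Longrightarrow> q' (- k) \<le> - b"
proof
  define I where "I = {0::real..} \<times> K"
  define \<phi> where "\<phi> x = (\<lambda>(t, k). q (x + t *\<^sub>R k) - t * b)" for x
  define q' where "q' x = (INF i\<in>I. \<phi> x i)" for x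
  have "I \<noteq> {}"
    using K by (auto simp: I_def)
  \<comment> \<open>A lower bound makes the real infimum meaningful; here \<open>b \<le> q k\<close>
    is used.\<close>
  have lower: "- q (- x) \<le> \<phi> x i" if iI: "i \<in> I" for x i
  proof -
    obtain t k where i: "i = (t, k)" "t \<ge> 0" "k \<in> K"
      using iI by (auto simp: I_def)
    have "t * b \<le> q (t *\<^sub>R k)"
      using i b by (simp add: sublinear_scaleR[OF q] mult_left_mono)
    also have "\<dots> \<le> q (x + t *\<^sub>R k) + q (- x)"
      using sublinear_add[OF q, of "x + t *\<^sub>R k" "- x"] by simp
    finally show ?thesis
      by (simp add: i \<phi>_def)
  qed
  have q'_le: "q' x \<le> \<phi> x i" if "i \<in> I" for x i
    unfolding q'_def using that lower by (intro cINF_lower bdd_belowI2) auto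
  show "q' x \<le> q x" for x
  proof -
    obtain k where "k \<in> K" using K by auto
    then show ?thesis
      using q'_le[of "(0, k)" x] by (simp add: I_def \<phi>_def)
  qed
  show "q' (- k) \<le> - b" if "k \<in> K" for k
    using q'_le[of "(1, k)" "- k"] that sublinear_scaleR[OF q, of 0 0] by (simp add: I_def \<phi>_def)
  show "sublinear q'"
  proof (rule sublinearI)
    fix x y
    show "q' (x + y) \<le> q' x + q' y"
      unfolding q'_def[of x] q'_def[of y]
    proof (rule le_cINF_add)
      fix i j assume "i \<in> I" "j \<in> I"
      then obtain t k s l where ij: "i = (t, k)" "j = (s, l)" "t \<ge> 0" "s \<ge> 0" "k \<in> K" "l \<in> K"
        by (auto simp: I_def)
      \<comment> \<open>The weighted mean of \<open>k\<close> and \<open>l\<close> accounts for both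
        shifts at once; if both weights vanish, any point of \<open>K\<close> does.\<close>
      obtain m where m: "m \<in> K" "(t + s) *\<^sub>R m = t *\<^sub>R k + s *\<^sub>R l"
      proof (cases "t + s = 0")
        case True
        with ij have "t = 0" "s = 0" by auto
        with ij that[of k] show ?thesis by auto
      next
        case False
        let ?m = "(t / (t + s)) *\<^sub>R k + (s / (t + s)) *\<^sub>R l"
        have "?m \<in> K"
          using K(1) ij False by (intro convexD) (auto simp flip: add_divide_distrib)
        with False that[of ?m] show ?thesis
          by (auto simp: scaleR_right_distrib)
      qed
      have "q' (x + y) \<le> \<phi> (x + y) (t + s, m)"
        using m ij by (intro q'_le) (auto simp: I_def)
      also have "\<dots> = q ((x + t *\<^sub>R k) + (y + s *\<^sub>R l)) - (t + s) * b"
        by (simp only: \<phi>_def m case_prod_conv) (simp add: algebra_simps)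
      also have "\<dots> \<le> \<phi> x i + \<phi> y j"
        using sublinear_add[OF q, of "x + t *\<^sub>R k" "y + s *\<^sub>R l"]
        by (simp add: \<phi>_def ij algebra_simps)
      finally show "q' (x + y) \<le> \<phi> x i + \<phi> y j" .
    qed (use \<open>I \<noteq> {}\<close> in auto)
  next
    fix t :: real and x assume t: "t > 0"
    have "q' (t *\<^sub>R x) / t \<le> q' x"
      unfolding q'_def[of x]
    proof (rule cINF_greatest)
      fix i assume "i \<in> I"
      then obtain s k where i: "i = (s, k)" "s \<ge> 0" "k \<in> K"
        by (auto simp: I_def)
      have "q' (t *\<^sub>R x) \<le> \<phi> (t *\<^sub>R x) (t * s, k)"
        using i t by (intro q'_le) (auto simp: I_def)
      also have "\<dots> = t * \<phi> x i"
        using sublinear_scaleR[OF q, of t "x + s *\<^sub>R k"] t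
        by (simp add: \<phi>_def i scaleR_right_distrib algebra_simps)
      finally show "q' (t *\<^sub>R x) / t \<le> \<phi> x i"
        using t by (simp add: field_simps)
    qed (use \<open>I \<noteq> {}\<close> in auto)
    then show "q' (t *\<^sub>R x) \<le> t * q' x"
      using t by (simp add: field_simps)
  qed
qed

text \<open>Hahn--Banach: a minimal sublinear functional below \<open>p\<close> is linear, because tilting it towards
  \<open>x\<close> cannot decrease it, whence \<open>q (- x) = - q x\<close>.\<close>

lemma sublinear_dominates_linear:
  fixes p :: "'a::real_vector \<Rightarrow> real"
  assumes p: "sublinear p"
  obtains f where "linear f" "\<And>x. f x \<le> p x"
proof -
  define S where "S = {q. sublinear q \<and> (\<forall>x. q x \<le> p x)}"
  \<comment> \<open>The order is reversed, so a Zorn-maximal element is a pointwise minimal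
    functional.\<close>
  define P where "P = (\<lambda>q r. \<forall>x::'a. r x \<le> (q x :: real))"
  have "\<exists>m\<in>S. \<forall>q\<in>S. P m q \<longrightarrow> q = m"
  proof (rule predicate_Zorn)
    show "partial_order_on S (relation_of P S)"
      by (rule partial_order_on_relation_ofI) (auto simp: P_def fun_eq_iff intro: order.trans antisym)
  next
    fix C assume C: "C \<in> Chains (relation_of P S)"
    then have CS: "C \<subseteq> S" and chain: "\<And>q r. q \<in> C \<Longrightarrow> r \<in> C \<Longrightarrow> P q r \<or> P r q"
      by (auto simp: Chains_def relation_of_def)
    show "\<exists>u\<in>S. \<forall>q\<in>C. P q u"
    proof (cases "C = {}")
      case True
      then show ?thesis using p by (auto simp: S_def)
    next
      case False
      \<comment> \<open>Members of the chain lie below \<open>p\<close>, hence above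
        \<open>- p (- x)\<close>, so the pointwise infimum is finite.\<close>
      define u where "u x = (INF q\<in>C. q x)" for x
      have lower: "- p (- x) \<le> q x" if "q \<in> C" for q x
      proof -
        have "sublinear q" "q (- x) \<le> p (- x)"
          using that CS by (auto simp: S_def)
        then show ?thesis
          using sublinear_minus[of q x] by simp
      qed
      have u_le: "u x \<le> q x" if "q \<in> C" for q x
        unfolding u_def using that lower by (intro cINF_lower bdd_belowI2) auto
      have "sublinear u"
      proof (rule sublinearI)
        fix x y
        show "u (x + y) \<le> u x + u y"
          unfolding u_def[of x] u_def[of y]
        proof (rule le_cINF_add)
          fix q r assume "q \<in> C" "r \<in> C"
          \<comment> \<open>The smaller of \<open>q\<close> and \<open>r\<close> in the chain; its
            own subadditivity then bounds both summands.\<close>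
          then obtain s where s: "s \<in> C" "\<And>z. s z \<le> q z" "\<And>z. s z \<le> r z"
            using chain[of q r] unfolding P_def by blast
          have "u (x + y) \<le> s x + s y"
            using u_le[OF s(1), of "x + y"] s(1) CS sublinear_add[of s x y] by (force simp: S_def)
          also have "\<dots> \<le> q x + r y"
            by (intro add_mono s)
          finally show "u (x + y) \<le> q x + r y" .
        qed (use False in auto)
      next
        fix t :: real and x assume t: "t > 0"
        have "u (t *\<^sub>R x) / t \<le> u x"
          unfolding u_def[of x]
        proof (rule cINF_greatest)
          fix q assume "q \<in> C"
          then have "u (t *\<^sub>R x) \<le> t * q x"
            using u_le[of q "t *\<^sub>R x"] CS sublinear_scaleR[of q t x] t by (auto simp: S_def)
          then show "u (t *\<^sub>R x) / t \<le> q x"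
            using t by (simp add: field_simps)
        qed (use False in auto)
        then show "u (t *\<^sub>R x) \<le> t * u x"
          using t by (simp add: field_simps)
      qed
      moreover have "u x \<le> p x" for x
        using False CS u_le by (force simp: S_def intro: order.trans)
      ultimately show ?thesis
        using u_le by (auto simp: S_def P_def)
    qed
  qed
  then obtain f where f: "f \<in> S" and min: "\<And>q. q \<in> S \<Longrightarrow> (\<And>x. q x \<le> f x) \<Longrightarrow> q = f"
    by (auto simp: P_def)
  then have sub: "sublinear f" and le: "\<And>x. f x \<le> p x"
    by (auto simp: S_def)
  have neg: "f (- x) = - f x" for x
  proof (rule antisym)
    obtain q where "sublinear q" "\<And>y. q y \<le> f y" "q (- x) \<le> - f x"
      using sublinear_tilt[OF sub, of "{x}" "f x"] by auto
    moreover from this le have "q = f"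
      by (intro min) (auto simp: S_def intro: order.trans)
    ultimately show "f (- x) \<le> - f x"
      by simp
    show "- f x \<le> f (- x)"
      using sublinear_minus[OF sub, of "x"] by simp
  qed
  have "linear f"
  proof
    fix x y
    show "f (x + y) = f x + f y"
      using sublinear_add[OF sub, of x y] sublinear_add[OF sub, of "- x" "- y"] neg[of "x + y"]
      by (simp add: neg)
  next
    fix t :: real and x
    show "f (t *\<^sub>R x) = t *\<^sub>R f x"
    proof (cases "t \<ge> 0")
      case False
      have "f (t *\<^sub>R x) = f ((- t) *\<^sub>R (- x))"
        by simp
      with False show ?thesis
        by (simp only: sublinear_scaleR[OF sub] neg) simp
    qed (simp add: sublinear_scaleR[OF sub])
  qed
  with le that show ?thesis
    by blast
qed

text \<open>Tilting the norm along \<open>K\<close> before applying Hahn-Banach builds the lower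
  bound on \<open>K\<close> into the dominating functional; domination by the norm makes the linear
  functional bounded.\<close>

lemma convex_functional_bounded_below:
  fixes K :: "'a::real_normed_vector set"
  assumes "convex K" "K \<noteq> {}" "\<And>k. k \<in> K \<Longrightarrow> \<eta> \<le> norm k"
  obtains f :: "'a \<Rightarrow>\<^sub>L real" where "\<And>k. k \<in> K \<Longrightarrow> \<eta> \<le> blinfun_apply f k"
proof -
  obtain p where p: "sublinear p" "\<And>x. p x \<le> norm x" "\<And>k. k \<in> K \<Longrightarrow> p (- k) \<le> - \<eta>"
    using sublinear_tilt[OF sublinear_norm assms] by blast
  obtain f where f: "linear f" "\<And>x. f x \<le> p x"
    using sublinear_dominates_linear[OF p(1)] by blast
  have le: "f x \<le> norm x" for x
    using f(2) p(2) order.trans by blast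
  have neg: "f (- x) = - f x" for x
    using f(1) by (rule linear_neg)
  have "\<bar>f x\<bar> \<le> norm x" for x
    using le[of x] le[of "- x"] by (simp add: neg)
  then have "bounded_linear f"
    using f(1) by (intro bounded_linear_intro[where K = 1])
      (auto simp: linear_add linear_scale)
  moreover have "\<eta> \<le> f k" if "k \<in> K" for k
    using f(2)[of "- k"] p(3)[OF that] by (simp add: neg)
  ultimately show ?thesis
    using that[of "Blinfun f"] by (simp add: bounded_linear_Blinfun_apply)
qed

section \<open>Mazur's theorem for weakly null families\<close>

text \<open>If all convex combinations had norm at least \<open>\<eta>\<close>, some bounded
  functional would be at least \<open>\<eta>\<close> at every \<open>x i\<close>, contradicting weak
  nullness on an infinite index set.\<close>

lemma weakly_null_small_convex_combination:
  fixes x :: "'i \<Rightarrow> 'a::real_normed_vector"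
  assumes x: "weakly_null_on I x" and I: "infinite I" and \<eta>: "\<eta> > 0"
  obtains B z where "finite B" "B \<noteq> {}" "B \<subseteq> I" "z \<in> convex hull (x ` B)" "norm z < \<eta>"
proof -
  let ?K = "convex hull (x ` I)"
  have "\<exists>z\<in>?K. norm z < \<eta>"
  proof (rule ccontr)
    assume "\<not> ?thesis"
    then have "\<eta> \<le> norm z" if "z \<in> ?K" for z
      using that by force
    moreover have "?K \<noteq> {}"
      using I by auto
    ultimately obtain f where f: "\<And>k. k \<in> ?K \<Longrightarrow> \<eta> \<le> blinfun_apply f k"
      using convex_functional_bounded_below[of ?K \<eta>] convex_convex_hull by blast
    \<comment> \<open>Halving \<open>\<eta>\<close> turns the weak bound into the strict inequality
      of \<open>weakly_null_on\<close>.\<close>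
    have "I \<subseteq> {i \<in> I. \<bar>blinfun_apply f (x i)\<bar> > \<eta> / 2}"
      using f[OF hull_inc] \<eta> by fastforce
    moreover have "finite {i \<in> I. \<bar>blinfun_apply f (x i)\<bar> > \<eta> / 2}"
      using x half_gt_zero[OF \<eta>] unfolding weakly_null_on_def by blast
    ultimately show False
      using I finite_subset by blast
  qed
  then obtain z S u where z: "norm z < \<eta>" "finite S" "S \<subseteq> x ` I"
      "\<forall>s\<in>S. 0 \<le> u s" "sum u S = 1" "(\<Sum>s\<in>S. u s *\<^sub>R s) = z"
    unfolding convex_hull_explicit by blast
  \<comment> \<open>\<open>x\<close> may repeat values, so the finite set of vectors is traced back
    to finitely many indices.\<close>
  obtain B where B: "finite B" "B \<subseteq> I" "S = x ` B"
    using finite_subset_image[OF z(2,3)] by blast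
  have "z \<in> convex hull (x ` B)"
    unfolding convex_hull_explicit using z B by blast
  moreover have "B \<noteq> {}"
    using z B by auto
  ultimately show ?thesis
    using that B z by blast
qed

section \<open>Ramsey's theorem and approximate spreading models\<close>

text \<open>The colours used below are functions; being finitely many, they are renamed injectively
  to an initial segment of the naturals, as \<open>Ramsey_nsets\<close> requires.\<close>

lemma Ramsey_finite_range:
  assumes "infinite Z" "finite (f ` nsets Z r)"
  obtains Y where "Y \<subseteq> Z" "infinite Y" "\<And>M N. M \<in> nsets Y r \<Longrightarrow> N \<in> nsets Y r \<Longrightarrow> f M = f N"
proof -
  obtain h :: "'b \<Rightarrow> nat" and s where h: "h ` f ` nsets Z r = {i. i < s}" "inj_on h (f ` nsets Z r)"
    using finite_imp_nat_seg_image_inj_on[OF assms(2)] finite_imp_inj_to_nat_seg[OF assms(2)] by blast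
  obtain Y t where Y: "Y \<subseteq> Z" "infinite Y" "(h \<circ> f) ` nsets Y r \<subseteq> {t}"
  proof (rule Ramsey_nsets)
    show "(h \<circ> f) ` nsets Z r \<subseteq> {..<s}"
      using h(1) by (simp only: image_comp[symmetric]) auto
  qed (use assms(1) in auto)
  moreover have "f M = f N" if "M \<in> nsets Y r" "N \<in> nsets Y r" for M N
  proof -
    have "M \<in> nsets Z r" "N \<in> nsets Z r"
      using that nsets_mono[OF Y(1)] by auto
    moreover have "h (f M) = h (f N)"
      using that Y(3) by (auto simp: image_subset_iff)
    ultimately show ?thesis
      using h(2) by (auto dest: inj_onD)
  qed
  ultimately show ?thesis
    using that by blast
qed

text \<open>Ramsey's theorem colours sets, whereas combinations are formed along tuples; an
  increasing tuple is recovered from its range.\<close>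

lemma sorted_list_of_set_strict_mono_nth:
  fixes m :: "nat \<Rightarrow> 'a::linorder"
  assumes "strict_mono_on {..<n} m" "i < n"
  shows "sorted_list_of_set (m ` {..<n}) ! i = m i"
proof -
  have "sorted_wrt (<) (map m [0..<n])"
    using assms(1) by (auto simp: sorted_wrt_iff_nth_less strict_mono_on_def)
  then have "sorted (map m [0..<n])" "distinct (map m [0..<n])"
    unfolding strict_sorted_iff by auto
  then have "sorted_list_of_set (set (map m [0..<n])) = map m [0..<n]"
    unfolding sorted_list_of_set_sort_remdups by (simp add: sorted_sort_id distinct_remdups_id)
  then show ?thesis
    using assms(2) by (simp add: atLeast0LessThan)
qed

lemma norm_sum_scaleR_le:
  fixes y :: "nat \<Rightarrow> 'a::real_normed_vector"
  assumes "\<And>k. norm (y k) \<le> 1"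
  shows "norm (\<Sum>i\<in>I. a i *\<^sub>R y (m i)) \<le> (\<Sum>i\<in>I. \<bar>a i\<bar>)"
proof (rule sum_norm_le)
  show "norm (a i *\<^sub>R y (m i)) \<le> \<bar>a i\<bar>" for i
    using mult_left_mono[OF assms, of "\<bar>a i\<bar>"] by simp
qed

text \<open>The colouring records the norms, rounded to multiples of \<open>\<delta>\<close>, of all combinations whose
  coefficients are multiples of \<open>\<delta>\<close> in \<open>[- 1, 1]\<close>, up to rounding at the end points.\<close>

lemma almost_spreading_subsequence:
  fixes y :: "nat \<Rightarrow> 'a::real_normed_vector" and n :: nat
  assumes y: "\<And>k. norm (y k) \<le> 1" and \<eta>: "\<eta> > 0"
  obtains H where "infinite H"
    "\<And>a m m'. \<lbrakk>\<And>i. i < n \<Longrightarrow> \<bar>a i\<bar> \<le> 1; strict_mono_on {..<n} m; strict_mono_on {..<n} m';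
        m ` {..<n} \<subseteq> H; m' ` {..<n} \<subseteq> H\<rbrakk> \<Longrightarrow>
      norm (\<Sum>i<n. a i *\<^sub>R y (m i)) \<le> norm (\<Sum>i<n. a i *\<^sub>R y (m' i)) + \<eta>"
proof -
  \<comment> \<open>Rounding the coefficients costs at most \<open>n * \<delta>\<close> for each of
    the two tuples, and rounding the norm costs \<open>\<delta>\<close>.\<close>
  define \<delta> where "\<delta> = \<eta> / (2 * n + 1)"
  have \<delta>: "\<delta> > 0"
    using \<eta> by (simp add: \<delta>_def)
  define D where "D = ({..<n} \<rightarrow>\<^sub>E {\<lfloor>- 1 / \<delta>\<rfloor>..\<lfloor>1 / \<delta>\<rfloor>})"
  define comb where "comb a m = (\<Sum>i<n. a i *\<^sub>R y (m i))" for a m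
  define grid where "grid d i = \<delta> * of_int (d i)" for d and i :: nat
  define col where
    "col M = (\<lambda>d\<in>D. \<lfloor>norm (comb (grid d) ((!) (sorted_list_of_set M))) / \<delta>\<rfloor>)" for M
  have "finite D"
    by (simp add: D_def finite_PiE)
  \<comment> \<open>Each \<open>y k\<close> has norm at most 1, so the recorded norms are bounded
    independently of \<open>M\<close> and only finitely many colours occur.\<close>
  have "col M \<in> (\<Pi>\<^sub>E d\<in>D. {0..\<lfloor>(\<Sum>i<n. \<bar>grid d i\<bar>) / \<delta>\<rfloor>})" for M
  proof -
    have "norm (comb (grid d) k) / \<delta> \<le> (\<Sum>i<n. \<bar>grid d i\<bar>) / \<delta>" for d k
      using \<delta> unfolding comb_def by (intro divide_right_mono norm_sum_scaleR_le y) simp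
    moreover have "0 \<le> norm (comb (grid d) k) / \<delta>" for d k
      using \<delta> by simp
    ultimately show ?thesis
      unfolding col_def restrict_PiE_iff atLeastAtMost_iff
      by (intro ballI conjI floor_mono) (simp_all only: zero_le_floor)
  qed
  then have "col ` nsets UNIV n \<subseteq> (\<Pi>\<^sub>E d\<in>D. {0..\<lfloor>(\<Sum>i<n. \<bar>grid d i\<bar>) / \<delta>\<rfloor>})"
    by blast
  then have "finite (col ` nsets UNIV n)"
    by (rule finite_subset) (simp add: finite_PiE \<open>finite D\<close>)
  then obtain H where H: "infinite H" "\<And>M N. M \<in> nsets H n \<Longrightarrow> N \<in> nsets H n \<Longrightarrow> col M = col N"
    using Ramsey_finite_range[of UNIV col n] by auto
  have "norm (comb a m) \<le> norm (comb a m') + \<eta>"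
    if a: "\<And>i. i < n \<Longrightarrow> \<bar>a i\<bar> \<le> 1" and m: "strict_mono_on {..<n} m" "m ` {..<n} \<subseteq> H"
      and m': "strict_mono_on {..<n} m'" "m' ` {..<n} \<subseteq> H" for a m m'
  proof -
    \<comment> \<open>Coefficients are rounded down to the grid; the restriction makes
      \<open>d\<close> extensional, as membership in \<open>D\<close> demands.\<close>
    define d where "d = (\<lambda>i\<in>{..<n}. \<lfloor>a i / \<delta>\<rfloor>)"
    have d: "d \<in> D"
      unfolding D_def d_def
    proof (rule restrict_PiE_iff[THEN iffD2], intro ballI)
      fix i assume "i \<in> {..<n}"
      with a[of i] have "- 1 \<le> a i" "a i \<le> 1"
        by auto
      with \<delta> show "\<lfloor>a i / \<delta>\<rfloor> \<in> {\<lfloor>- 1 / \<delta>\<rfloor>..\<lfloor>1 / \<delta>\<rfloor>}"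
        unfolding atLeastAtMost_iff by (intro conjI floor_mono divide_right_mono) auto
    qed
    have close: "norm (comb a k - comb (grid d) k) \<le> n * \<delta>" for k
    proof -
      have "\<bar>a i - grid d i\<bar> \<le> \<delta>" if "i < n" for i
      proof -
        have "\<bar>a i / \<delta> - of_int \<lfloor>a i / \<delta>\<rfloor>\<bar> \<le> 1"
          by linarith
        then have "\<delta> * \<bar>a i / \<delta> - of_int \<lfloor>a i / \<delta>\<rfloor>\<bar> \<le> \<delta>"
          using \<delta> by simp
        moreover have "a i - grid d i = \<delta> * (a i / \<delta> - of_int \<lfloor>a i / \<delta>\<rfloor>)"
          using that \<delta> by (simp add: grid_def d_def right_diff_distrib)
        ultimately show ?thesis
          using \<delta> by (simp add: abs_mult)
      qed
      then have "(\<Sum>i<n. \<bar>a i - grid d i\<bar>) \<le> n * \<delta>"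
        using sum_bounded_above[of "{..<n}" "\<lambda>i. \<bar>a i - grid d i\<bar>" \<delta>] by simp
      moreover have "comb a k - comb (grid d) k = (\<Sum>i<n. (a i - grid d i) *\<^sub>R y (k i))"
        by (simp add: comb_def scaleR_diff_left sum_subtractf)
      ultimately show ?thesis
        using norm_sum_scaleR_le[of y "\<lambda>i. a i - grid d i" k "{..<n}", OF y] by simp
    qed
    have nsets: "k ` {..<n} \<in> nsets H n" if "strict_mono_on {..<n} k" "k ` {..<n} \<subseteq> H" for k
      using that strict_mono_on_imp_inj_on[OF that(1)] by (auto simp: nsets_def card_image)
    have floor: "col (k ` {..<n}) d = \<lfloor>norm (comb (grid d) k) / \<delta>\<rfloor>"
      if "strict_mono_on {..<n} k" for k
      using d that by (simp add: col_def comb_def sorted_list_of_set_strict_mono_nth)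
    have "\<lfloor>norm (comb (grid d) m) / \<delta>\<rfloor> = \<lfloor>norm (comb (grid d) m') / \<delta>\<rfloor>"
      using H(2)[OF nsets[OF m] nsets[OF m']] floor[OF m(1)] floor[OF m'(1)] by simp
    then have "norm (comb (grid d) m) / \<delta> \<le> norm (comb (grid d) m') / \<delta> + 1"
      by linarith
    then have "norm (comb (grid d) m) \<le> norm (comb (grid d) m') + \<delta>"
      using \<delta> by (simp add: field_simps)
    then have "norm (comb a m) \<le> norm (comb a m') + (2 * n + 1) * \<delta>"
      using close[of m] close[of m'] norm_triangle_sub[of "comb a m" "comb (grid d) m"]
        norm_triangle_sub[of "comb (grid d) m'" "comb a m'"]
      by (simp add: norm_minus_commute algebra_simps)
    then show ?thesis
      by (simp add: \<delta>_def)
  qed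
  with H(1) that show ?thesis
    unfolding comb_def by blast
qed

section \<open>Subfamilies and reindexing\<close>

lemma weakly_null_on_subset: "weakly_null_on I x \<Longrightarrow> J \<subseteq> I \<Longrightarrow> weakly_null_on J x"
  unfolding weakly_null_on_def
  by (elim all_forward imp_forward) (auto elim!: rev_finite_subset)

lemma weakly_null_on_reindex:
  assumes "weakly_null_on (g ` I) x" "inj_on g I"
  shows "weakly_null_on I (x \<circ> g)"
  unfolding weakly_null_on_def
proof (intro allI impI)
  fix f :: "'b \<Rightarrow>\<^sub>L real" and \<delta> :: real assume "\<delta> > 0"
  then have "finite {\<alpha> \<in> g ` I. \<bar>blinfun_apply f (x \<alpha>)\<bar> > \<delta>}"
    using assms(1) by (simp add: weakly_null_on_def)
  moreover have "g ` {i \<in> I. \<bar>blinfun_apply f ((x \<circ> g) i)\<bar> > \<delta>}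
      = {\<alpha> \<in> g ` I. \<bar>blinfun_apply f (x \<alpha>)\<bar> > \<delta>}"
    by auto
  ultimately show "finite {i \<in> I. \<bar>blinfun_apply f ((x \<circ> g) i)\<bar> > \<delta>}"
    using finite_imageD[OF _ inj_on_subset[OF assms(2)], of "{i \<in> I. \<bar>blinfun_apply f ((x \<circ> g) i)\<bar> > \<delta>}"]
    by auto
qed

lemma suppression_unconditional_on_subset:
  "suppression_unconditional_on C I e \<Longrightarrow> J \<subseteq> I \<Longrightarrow> suppression_unconditional_on C J e"
  unfolding suppression_unconditional_on_def normalized_on_def by auto

text \<open>Each inequality lives inside the finite set \<open>B\<close>, and normalization is read
  off singletons. This carries the property from finite sets to all of \<open>K1\<close>.\<close>

lemma suppression_unconditional_on_finite_subsets:
  assumes "1 \<le> C" "\<And>M. finite M \<Longrightarrow> M \<subseteq> I \<Longrightarrow> suppression_unconditional_on C M e"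
  shows "suppression_unconditional_on C I e"
  unfolding suppression_unconditional_on_def
proof (intro conjI allI impI)
  show "normalized_on I e"
    unfolding normalized_on_def
  proof
    fix i assume "i \<in> I"
    with assms(2)[of "{i}"] show "norm (e i) = 1"
      by (simp add: suppression_unconditional_on_def normalized_on_def)
  qed
next
  fix A B and c :: "'a \<Rightarrow> real" assume "finite B \<and> A \<subseteq> B \<and> B \<subseteq> I"
  with assms(2)[of B] show "norm (\<Sum>\<alpha>\<in>A. c \<alpha> *\<^sub>R e \<alpha>) \<le> C * norm (\<Sum>\<alpha>\<in>B. c \<alpha> *\<^sub>R e \<alpha>)"
    by (simp add: suppression_unconditional_on_def)
qed (fact assms(1))

lemma suppression_unconditional_on_reindex:
  assumes inj: "inj_on g I"
  shows "suppression_unconditional_on C (g ` I) x \<longleftrightarrow> suppression_unconditional_on C I (x \<circ> g)"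
    (is "?L \<longleftrightarrow> ?R")
proof
  assume L: ?L
  show ?R
    unfolding suppression_unconditional_on_def
  proof (intro conjI allI impI)
    show "1 \<le> C" "normalized_on I (x \<circ> g)"
      using L by (auto simp: suppression_unconditional_on_def normalized_on_def)
    fix A B and c :: "'a \<Rightarrow> real" assume AB: "finite B \<and> A \<subseteq> B \<and> B \<subseteq> I"
    \<comment> \<open>The inverse of \<open>g\<close> moves coefficients from \<open>I\<close> to
      the image; the converse direction only composes with \<open>g\<close>.\<close>
    let ?c = "c \<circ> the_inv_into I g"
    have eq: "(\<Sum>\<alpha>\<in>g ` S. ?c \<alpha> *\<^sub>R x \<alpha>) = (\<Sum>i\<in>S. c i *\<^sub>R (x \<circ> g) i)" if "S \<subseteq> I" for S
      using that inj
      by (subst sum.reindex) (auto simp: inj_on_subset the_inv_into_f_f subset_iff intro!: sum.cong)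
    have "norm (\<Sum>\<alpha>\<in>g ` A. ?c \<alpha> *\<^sub>R x \<alpha>) \<le> C * norm (\<Sum>\<alpha>\<in>g ` B. ?c \<alpha> *\<^sub>R x \<alpha>)"
    proof -
      have "finite (g ` B) \<and> g ` A \<subseteq> g ` B \<and> g ` B \<subseteq> g ` I"
        using AB by auto
      then show ?thesis
        using L by (simp add: suppression_unconditional_on_def)
    qed
    with AB show "norm (\<Sum>i\<in>A. c i *\<^sub>R (x \<circ> g) i) \<le> C * norm (\<Sum>i\<in>B. c i *\<^sub>R (x \<circ> g) i)"
      using eq[of A] eq[of B] by auto
  qed
next
  assume R: ?R
  show ?L
    unfolding suppression_unconditional_on_def
  proof (intro conjI allI impI)
    show "1 \<le> C" "normalized_on (g ` I) x"
      using R by (auto simp: suppression_unconditional_on_def normalized_on_def)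
    fix A B and c :: "'b \<Rightarrow> real" assume AB: "finite B \<and> A \<subseteq> B \<and> B \<subseteq> g ` I"
    then obtain B' where B': "B' \<subseteq> I" "finite B'" "B = g ` B'"
      by (meson finite_subset_image)
    then obtain A' where A': "A' \<subseteq> B'" "A = g ` A'"
      using AB by (meson subset_imageE)
    have eq: "(\<Sum>\<alpha>\<in>g ` S. c \<alpha> *\<^sub>R x \<alpha>) = (\<Sum>i\<in>S. (c \<circ> g) i *\<^sub>R (x \<circ> g) i)" if "S \<subseteq> I" for S
      using that inj by (subst sum.reindex) (auto simp: inj_on_subset)
    show "norm (\<Sum>\<alpha>\<in>A. c \<alpha> *\<^sub>R x \<alpha>) \<le> C * norm (\<Sum>\<alpha>\<in>B. c \<alpha> *\<^sub>R x \<alpha>)"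
    proof -
      have "norm (\<Sum>i\<in>A'. (c \<circ> g) i *\<^sub>R (x \<circ> g) i) \<le> C * norm (\<Sum>i\<in>B'. (c \<circ> g) i *\<^sub>R (x \<circ> g) i)"
        using R A' B' unfolding suppression_unconditional_on_def by blast
      with A' B' show ?thesis
        using eq[of A'] eq[of B'] by auto
    qed
  qed
qed

section \<open>Finite suppression unconditional subsets\<close>

text \<open>Sublevel sets of the norm along an affine map are convex, so a bound at the points of a
  block passes to their convex hull.\<close>

lemma convex_norm_affine_le: "convex {w. norm (v + a *\<^sub>R w) \<le> r}"
  for v :: "'a::real_normed_vector"
proof (rule convexI)
  fix w w' and s t :: real
  assume *: "w \<in> {w. norm (v + a *\<^sub>R w) \<le> r}" "w' \<in> {w. norm (v + a *\<^sub>R w) \<le> r}"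
    and st: "0 \<le> s" "0 \<le> t" "s + t = 1"
  have "v = s *\<^sub>R v + t *\<^sub>R v"
    using st by (metis scaleR_left_distrib scaleR_one)
  then have "v + a *\<^sub>R (s *\<^sub>R w + t *\<^sub>R w') = s *\<^sub>R (v + a *\<^sub>R w) + t *\<^sub>R (v + a *\<^sub>R w')"
    by (simp add: algebra_simps)
  also have "norm \<dots> \<le> s * norm (v + a *\<^sub>R w) + t * norm (v + a *\<^sub>R w')"
    using st norm_triangle_ineq[of "s *\<^sub>R (v + a *\<^sub>R w)" "t *\<^sub>R (v + a *\<^sub>R w')"] by simp
  also have "\<dots> \<le> s * r + t * r"
    using * st by (intro add_mono mult_left_mono) auto
  also have "\<dots> = r"
    using st by (simp flip: distrib_right)
  finally show "s *\<^sub>R w + t *\<^sub>R w' \<in> {w. norm (v + a *\<^sub>R w) \<le> r}"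
    by simp
qed

lemma norm_sum_hull_le:
  fixes y :: "'b \<Rightarrow> 'a::real_normed_vector" and z :: "'i \<Rightarrow> 'a"
  assumes "finite F" "finite I" "F \<subseteq> I"
    and z: "\<And>i. i \<in> F \<Longrightarrow> z i \<in> convex hull (y ` B i)"
    and le: "\<And>k. (\<And>i. i \<in> I \<Longrightarrow> k i \<in> B i) \<Longrightarrow> norm (\<Sum>i\<in>I. a i *\<^sub>R y (k i)) \<le> r"
    and k: "\<And>i. i \<in> I \<Longrightarrow> k i \<in> B i"
  shows "norm (\<Sum>i\<in>I. a i *\<^sub>R (if i \<in> F then z i else y (k i))) \<le> r"
  using assms(1,3) z k
proof (induction F arbitrary: k rule: finite_induct)
  case empty
  then show ?case
    using le by simp
next
  case (insert j F)
  define u where "u k i = (if i \<in> F then z i else y (k i))" for k i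
  define v where "v = (\<Sum>i\<in>I - {j}. a i *\<^sub>R u k i)"
  have j: "j \<in> I" "j \<notin> F"
    using insert by auto
  have split: "(\<Sum>i\<in>I. a i *\<^sub>R w i) = (\<Sum>i\<in>I - {j}. a i *\<^sub>R w i) + a j *\<^sub>R w j" for w :: "'i \<Rightarrow> 'a"
    using \<open>finite I\<close> j by (simp add: sum.remove add.commute)
  have "y ` B j \<subseteq> {w. norm (v + a j *\<^sub>R w) \<le> r}"
  proof (intro image_subsetI CollectI)
    fix b assume b: "b \<in> B j"
    \<comment> \<open>The selection \<open>k\<close> varies in the induction, so the hypothesis
      applies with \<open>b\<close> in place of \<open>k j\<close>.\<close>
    have "norm (\<Sum>i\<in>I. a i *\<^sub>R u (k(j := b)) i) \<le> r"
      unfolding u_def using insert.prems b by (intro insert.IH) auto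
    moreover have "(\<Sum>i\<in>I - {j}. a i *\<^sub>R u (k(j := b)) i) = v"
      unfolding v_def u_def by (intro sum.cong) auto
    ultimately show "norm (v + a j *\<^sub>R y b) \<le> r"
      using j by (simp add: split) (simp add: u_def)
  qed
  then have "convex hull (y ` B j) \<subseteq> {w. norm (v + a j *\<^sub>R w) \<le> r}"
    by (intro hull_minimal convex_norm_affine_le)
  then have "norm (v + a j *\<^sub>R z j) \<le> r"
    using insert.prems(2)[of j] by auto
  moreover have "(\<Sum>i\<in>I - {j}. a i *\<^sub>R (if i \<in> insert j F then z i else y (k i))) = v"
    unfolding v_def u_def by (intro sum.cong) auto
  ultimately show ?case
    by (simp add: split)
qed

text \<open>Turns an additive error into a factor. After scaling the largest coefficient to absolute
  value 1, keeping that coordinate alone shows that the full norm \<open>N\<close> satisfies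
  \<open>1 \<le> N + s\<close>. Hence \<open>N \<ge> 1 / 2\<close> and
  \<open>s \<le> \<epsilon> / 2 \<le> \<epsilon> * N\<close>.\<close>

lemma suppression_unconditional_on_bounded_coefficients:
  fixes e :: "'i \<Rightarrow> 'a::real_normed_vector"
  assumes I: "finite I" "normalized_on I e" and \<epsilon>: "0 \<le> \<epsilon>" and s: "s \<le> 1 / 2" "s \<le> \<epsilon> / 2"
    and le: "\<And>a A. A \<subseteq> I \<Longrightarrow> (\<And>i. i \<in> I \<Longrightarrow> \<bar>a i\<bar> \<le> 1) \<Longrightarrow>
        norm (\<Sum>i\<in>A. a i *\<^sub>R e i) \<le> norm (\<Sum>i\<in>I. a i *\<^sub>R e i) + s"
  shows "suppression_unconditional_on (1 + \<epsilon>) I e"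
  unfolding suppression_unconditional_on_def
proof (intro conjI allI impI)
  fix A B and c :: "'i \<Rightarrow> real" assume AB: "finite B \<and> A \<subseteq> B \<and> B \<subseteq> I"
  show "norm (\<Sum>i\<in>A. c i *\<^sub>R e i) \<le> (1 + \<epsilon>) * norm (\<Sum>i\<in>B. c i *\<^sub>R e i)"
  proof (cases "\<forall>i\<in>B. c i = 0")
    case True
    moreover from this AB have "\<forall>i\<in>A. c i = 0"
      by blast
    ultimately show ?thesis
      by simp
  next
    case False
    define t where "t = Max ((\<lambda>i. \<bar>c i\<bar>) ` B)"
    have "t \<in> (\<lambda>i. \<bar>c i\<bar>) ` B"
      unfolding t_def using AB False by (intro Max_in) auto
    then obtain j where j: "j \<in> B" "t = \<bar>c j\<bar>"
      by auto
    have t_ge: "\<bar>c i\<bar> \<le> t" if "i \<in> B" for i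
      unfolding t_def using AB that by (intro Max_ge) auto
    have t: "t > 0"
      using False t_ge by fastforce
    \<comment> \<open>Extension by zero lets the hypothesis, stated for sums over all of
      \<open>I\<close>, speak about \<open>B\<close>.\<close>
    define a where "a i = (if i \<in> B then c i / t else 0)" for i
    have a: "\<bar>a i\<bar> \<le> 1" for i
      using t t_ge by (simp add: a_def)
    have sum_a: "(\<Sum>i\<in>S. a i *\<^sub>R e i) = (1 / t) *\<^sub>R (\<Sum>i\<in>S. c i *\<^sub>R e i)" if "S \<subseteq> B" for S
      using that by (auto simp: a_def scaleR_sum_right intro!: sum.cong)
    have sum_I: "(\<Sum>i\<in>I. a i *\<^sub>R e i) = (\<Sum>i\<in>B. a i *\<^sub>R e i)"
      using AB I by (intro sum.mono_neutral_right) (auto simp: a_def)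
    define N where "N = norm (\<Sum>i\<in>B. a i *\<^sub>R e i)"
    have "norm (e j) = 1"
      using I j AB by (auto simp: normalized_on_def)
    then have "1 \<le> N + s"
    proof -
      have "norm (\<Sum>i\<in>{j}. a i *\<^sub>R e i) = 1"
        using \<open>norm (e j) = 1\<close> j t by (simp add: a_def)
      with le[of "{j}" a] a j AB show ?thesis
        by (auto simp: N_def sum_I)
    qed
    then have "s \<le> \<epsilon> * N"
      using s \<epsilon> mult_left_mono[of "1 / 2" N \<epsilon>] by simp
    moreover have "norm (\<Sum>i\<in>A. a i *\<^sub>R e i) \<le> N + s"
      using le[of A a] a AB by (auto simp: N_def sum_I)
    ultimately have "norm (\<Sum>i\<in>A. a i *\<^sub>R e i) \<le> (1 + \<epsilon>) * N"
      by (simp add: algebra_simps)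
    then show ?thesis
      using AB t by (simp add: N_def sum_a divide_right_mono field_simps)
  qed
qed (use \<epsilon> I in auto)

text \<open>Suppressing a coordinate means replacing its vector by a small convex combination taken from
  a block of indices: by convexity of the norm, and since all increasing \<open>n\<close>-tuples behave almost
  alike, the norm hardly grows.\<close>

lemma weakly_null_finite_suppression_unconditional:
  fixes y :: "nat \<Rightarrow> 'a::real_normed_vector"
  assumes norm: "normalized_on UNIV y" and null: "weakly_null_on UNIV y" and \<epsilon>: "\<epsilon> > 0"
  obtains M where "M \<in> nsets UNIV n" "suppression_unconditional_on (1 + \<epsilon>) M y"
proof -
  \<comment> \<open>One \<open>\<eta>\<close> pays for the change of tuple and at most
    \<open>n\<close> more for the small vectors; the total \<open>min 1 \<epsilon> / 2\<close> meets
    both bounds required of \<open>s\<close>.\<close>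
  define \<eta> where "\<eta> = min 1 \<epsilon> / (2 * (real n + 1))"
  have \<eta>: "\<eta> > 0"
    using \<epsilon> by (simp add: \<eta>_def)
  have n\<eta>: "(real n + 1) * \<eta> = min 1 \<epsilon> / 2"
    by (simp add: \<eta>_def field_simps)
  have y1: "norm (y k) = 1" for k
    using norm by (simp add: normalized_on_def)
  then have "norm (y k) \<le> 1" for k
    by simp
  then obtain H where H: "infinite H" and
    spread: "\<And>a m m'. \<lbrakk>\<And>i. i < n \<Longrightarrow> \<bar>a i\<bar> \<le> 1; strict_mono_on {..<n} m; strict_mono_on {..<n} m';
        m ` {..<n} \<subseteq> H; m' ` {..<n} \<subseteq> H\<rbrakk> \<Longrightarrow>
      norm (\<Sum>i<n. a i *\<^sub>R y (m i)) \<le> norm (\<Sum>i<n. a i *\<^sub>R y (m' i)) + \<eta>"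
    using almost_spreading_subsequence[OF _ \<eta>, of y n] by blast
  define block where
    "block = (\<lambda>(B, z). finite B \<and> B \<noteq> {} \<and> B \<subseteq> H \<and> z \<in> convex hull (y ` B) \<and> norm z < \<eta>)"
  have ex_block: "\<exists>B. block B \<and> fst B \<subseteq> {N..}" for N
  proof -
    have "infinite (H \<inter> {N..})"
    proof
      assume "finite (H \<inter> {N..})"
      then have "finite (H \<inter> {N..} \<union> {..<N})"
        by simp
      moreover have "H \<subseteq> H \<inter> {N..} \<union> {..<N}"
        by auto
      ultimately show False
        using H finite_subset by blast
    qed
    then obtain B z where "finite B" "B \<noteq> {}" "B \<subseteq> H \<inter> {N..}" "z \<in> convex hull (y ` B)" "norm z < \<eta>"
      using weakly_null_small_convex_combination[OF weakly_null_on_subset[OF null subset_UNIV] _ \<eta>]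
      by metis
    then show ?thesis
      by (intro exI[of _ "(B, z)"]) (auto simp: block_def)
  qed
  \<comment> \<open>Each block starts beyond the maximum of the previous one, so one index from each
    block gives an increasing tuple.\<close>
  have "\<exists>f. \<forall>i::nat. block (f i) \<and> (\<forall>b\<in>fst (f i). \<forall>b'\<in>fst (f (Suc i)). b < b')"
  proof (rule dependent_nat_choice)
    show "\<exists>B. block B"
      using ex_block by blast
  next
    fix B :: "nat set \<times> 'a" and i :: nat assume "block B"
    then have fin: "finite (fst B)"
      by (auto simp: block_def)
    obtain B' where B': "block B'" "fst B' \<subseteq> {Suc (Max (fst B))..}"
      using ex_block by blast
    moreover have "b < b'" if "b \<in> fst B" "b' \<in> fst B'" for b b'
      using Max_ge[OF fin that(1)] that(2) B'(2) by auto
    ultimately show "\<exists>B'. block B' \<and> (\<forall>b\<in>fst B. \<forall>b'\<in>fst B'. b < b')"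
      by blast
  qed
  then obtain f where f: "\<And>i. block (f i)"
    and step: "\<And>i b b'. b \<in> fst (f i) \<Longrightarrow> b' \<in> fst (f (Suc i)) \<Longrightarrow> b < b'"
    by blast
  define B where "B i = fst (f i)" for i
  define z where "z i = snd (f i)" for i
  have B: "B i \<noteq> {}" "B i \<subseteq> H" "z i \<in> convex hull (y ` B i)" "norm (z i) < \<eta>" for i
    using f[of i] by (auto simp: block_def B_def z_def split: prod.splits)
  have less: "b < b'" if "i < j" "b \<in> B i" "b' \<in> B j" for i j b b'
    using that
  proof (induction j arbitrary: b')
    case (Suc j)
    show ?case
    proof (cases "i = j")
      case True
      with Suc.prems step show ?thesis by (auto simp: B_def)
    next
      case False
      \<comment> \<open>Nonempty blocks let the comparison pass through an intermediate
        index.\<close>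
      obtain b'' where "b'' \<in> B j" using B(1) by blast
      with False Suc step[of b'' j b'] show ?thesis
        by (force simp: B_def)
    qed
  qed simp
  have mono: "strict_mono_on {..<n} k" if "\<And>i. i < n \<Longrightarrow> k i \<in> B i" for k
    using that less by (intro strict_mono_onI) auto
  have inH: "k ` {..<n} \<subseteq> H" if "\<And>i. i < n \<Longrightarrow> k i \<in> B i" for k
    using that B(2) by blast
  define m where "m i = (SOME b. b \<in> B i)" for i
  have m: "m i \<in> B i" for i
    unfolding m_def using B(1) by (simp add: some_in_eq)
  have inj: "inj_on m {..<n}"
    using strict_mono_on_imp_inj_on[OF mono[OF m]] .
  have "suppression_unconditional_on (1 + \<epsilon>) {..<n} (y \<circ> m)"
  proof (rule suppression_unconditional_on_bounded_coefficients)
    fix a :: "nat \<Rightarrow> real" and A assume A: "A \<subseteq> {..<n}" and a: "\<And>i. i \<in> {..<n} \<Longrightarrow> \<bar>a i\<bar> \<le> 1"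
    define F where "F = {..<n} - A"
    define S where "S = norm (\<Sum>i<n. a i *\<^sub>R y (m i))"
    define u where "u i = a i *\<^sub>R (if i \<in> F then z i else y (m i))" for i
    have "norm (\<Sum>i<n. u i) \<le> S + \<eta>"
      unfolding u_def
    proof (rule norm_sum_hull_le[where B = B and y = y and k = m])
      \<comment> \<open>Any selection from the blocks is an increasing tuple in \<open>H\<close>, so
        \<open>spread\<close> compares it with \<open>m\<close>.\<close>
      fix k assume "\<And>i. i \<in> {..<n} \<Longrightarrow> k i \<in> B i"
      then show "norm (\<Sum>i<n. a i *\<^sub>R y (k i)) \<le> S + \<eta>"
        unfolding S_def using a m by (intro spread mono inH) auto
    qed (simp_all add: F_def B(3) m subset_iff)
    moreover have "norm (\<Sum>i\<in>F. u i) \<le> n * \<eta>"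
    proof -
      have "norm (u i) \<le> \<eta>" if "i \<in> F" for i
        using that B(4)[of i] a[of i] mult_mono[of "\<bar>a i\<bar>" 1 "norm (z i)" \<eta>]
        by (auto simp: u_def F_def)
      then have "norm (\<Sum>i\<in>F. u i) \<le> of_nat (card F) * \<eta>"
        by (intro order.trans[OF norm_sum sum_bounded_above])
      also have "\<dots> \<le> n * \<eta>"
        using \<eta> card_mono[of "{..<n}" F] by (intro mult_right_mono) (auto simp: F_def)
      finally show ?thesis .
    qed
    moreover have "(\<Sum>i<n. u i) = (\<Sum>i\<in>A. a i *\<^sub>R y (m i)) + (\<Sum>i\<in>F. u i)"
    proof -
      have "(\<Sum>i\<in>A. u i) = (\<Sum>i\<in>A. a i *\<^sub>R y (m i))"
        by (intro sum.cong) (auto simp: u_def F_def)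
      then show ?thesis
        using sum.subset_diff[OF A, of u] by (simp add: F_def)
    qed
    ultimately have "norm (\<Sum>i\<in>A. a i *\<^sub>R y (m i)) \<le> S + (real n + 1) * \<eta>"
      using norm_triangle_ineq4[of "\<Sum>i<n. u i" "\<Sum>i\<in>F. u i"]
      by (simp add: algebra_simps)
    then show "norm (\<Sum>i\<in>A. a i *\<^sub>R (y \<circ> m) i) \<le> norm (\<Sum>i<n. a i *\<^sub>R (y \<circ> m) i) + min 1 \<epsilon> / 2"
      by (simp add: S_def n\<eta>)
  qed (use \<epsilon> y1 in \<open>auto simp: normalized_on_def\<close>)
  then have "suppression_unconditional_on (1 + \<epsilon>) (m ` {..<n}) y"
    by (simp add: suppression_unconditional_on_reindex[OF inj])
  moreover have "m ` {..<n} \<in> nsets UNIV n"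
    using inj by (simp add: nsets_def card_image)
  ultimately show ?thesis
    using that by blast
qed

section \<open>Increasing copies of cardinals and the conclusion\<close>

text \<open>The order induced on \<open>K\<close> may be longer than \<open>s\<close>, but
  \<open>s\<close> is isomorphic to the least well-order on \<open>K\<close> and so embeds into the
  induced one.\<close>

lemma strictly_increasing_between_card_of:
  fixes r :: "'k rel" and s :: "'l rel"
  assumes "Well_order r" "K \<subseteq> Field r" "Well_order s" "|K| =o s"
  obtains g where "strictly_increasing_between s r g" "g ` Field s \<subseteq> K" "inj_on g (Field s)"
proof -
  have K: "well_order_on K (Restr r K)"
    using assms by (simp add: well_order_on_Restr)
  have FieldK: "Field (Restr r K) = K"
    using well_order_on_Well_order[OF K] by simp
  have "s \<le>o Restr r K"
    using ordIso_ordLeq_trans[OF ordIso_symmetric[OF assms(4)] card_of_least[OF K]] .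
  then obtain g where g: "embed s (Restr r K) g"
    unfolding ordLeq_def by blast
  have inj: "inj_on g (Field s)"
    using embed_inj_on[OF assms(3) g] .
  have into: "g ` Field s \<subseteq> K"
    using embed_Field[OF g] FieldK by blast
  have compat: "compat s (Restr r K) g"
    using embed_compat[OF g] .
  have "strictly_increasing_between s r g"
    unfolding strictly_increasing_between_def monotone_on_def
  proof (intro conjI ballI impI)
    show "g \<in> Field s \<rightarrow> Field r"
      using into assms(2) by blast
  next
    fix \<sigma> \<tau> assume "\<sigma> \<in> Field s" "\<tau> \<in> Field s" "(\<sigma>, \<tau>) \<in> s - Id"
    then show "(g \<sigma>, g \<tau>) \<in> r - Id"
      using compat inj_on_eq_iff[OF inj] by (simp add: compat_def)
  qed
  with inj into that show ?thesis
    by blast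
qed

theorem theorem3p2:
  fixes \<kappa> :: "'k rel" and \<Lambda> :: "'l rel"
  assumes "Cinfinite \<kappa>" and "Cinfinite \<Lambda>"
    and "\<And>c :: 'k set \<Rightarrow> nat. c \<in> Fpow (Field \<kappa>) \<rightarrow> {0, 1} \<Longrightarrow>
           \<exists>K0 K1. K0 \<subseteq> Field \<kappa> \<and> K1 \<subseteq> Field \<kappa> \<and> |K0| =o natLeq \<and> |K1| =o \<Lambda> \<and>
             (cofinal_subfamily {M \<in> Fpow K1. c M = 1} (Fpow K1) \<or>
              (\<exists>n>1. c ` nsets K0 n = {0}))"
  shows "\<forall>\<epsilon>>0. \<forall>x :: 'k \<Rightarrow> 'x::banach.
           normalized_on (Field \<kappa>) x \<and> weakly_null_on (Field \<kappa>) x \<longrightarrow>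
           (\<exists>g. strictly_increasing_between \<Lambda> \<kappa> g \<and>
                suppression_unconditional_on (1 + \<epsilon>) (Field \<Lambda>) (x \<circ> g))"
proof (intro allI impI, elim conjE)
  fix \<epsilon> :: real and x :: "'k \<Rightarrow> 'x"
  assume \<epsilon>: "\<epsilon> > 0" and norm: "normalized_on (Field \<kappa>) x" and null: "weakly_null_on (Field \<kappa>) x"
  define c :: "'k set \<Rightarrow> nat" where
    "c M = (if suppression_unconditional_on (1 + \<epsilon>) M x then 1 else 0)" for M
  have c: "c \<in> Fpow (Field \<kappa>) \<rightarrow> {0, 1}"
    by (simp add: c_def)
  obtain K0 K1 where K: "K0 \<subseteq> Field \<kappa>" "K1 \<subseteq> Field \<kappa>" "|K0| =o natLeq" "|K1| =o \<Lambda>"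
    and alt: "cofinal_subfamily {M \<in> Fpow K1. c M = 1} (Fpow K1) \<or> (\<exists>n>1. c ` nsets K0 n = {0})"
    using assms(3)[OF c] by (elim exE conjE) (rule that)
  have "\<not> c ` nsets K0 n \<subseteq> {0}" for n
  proof -
    \<comment> \<open>The enumeration of \<open>K0\<close> need not respect the order of
      \<open>\<kappa>\<close>: weak nullness, suppression unconditionality and the colouring ignore
      it.\<close>
    have "|UNIV :: nat set| =o |K0|"
      using ordIso_transitive[OF card_of_nat ordIso_symmetric[OF K(3)]] .
    then obtain e :: "nat \<Rightarrow> 'k" where e: "bij_betw e UNIV K0"
      using card_of_ordIso[of "UNIV :: nat set" K0] by metis
    then have inj: "inj e" and img: "range e = K0"
      by (auto simp: bij_betw_def)
    have "normalized_on UNIV (x \<circ> e)"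
      using norm K(1) img by (auto simp: normalized_on_def)
    moreover have "weakly_null_on UNIV (x \<circ> e)"
      using weakly_null_on_subset[OF null K(1)] img by (intro weakly_null_on_reindex[OF _ inj]) simp
    ultimately obtain M where M: "M \<in> nsets UNIV n" "suppression_unconditional_on (1 + \<epsilon>) M (x \<circ> e)"
      using weakly_null_finite_suppression_unconditional[of "x \<circ> e" \<epsilon> n] \<epsilon> by metis
    have injM: "inj_on e M"
      using inj by (rule inj_on_subset) simp
    have "c (e ` M) = 1"
      using M(2) by (simp add: c_def suppression_unconditional_on_reindex[OF injM])
    moreover have "e ` M \<in> nsets K0 n"
      using M(1) img by (auto simp: nsets_def card_image[OF injM])
    ultimately have "1 \<in> c ` nsets K0 n"
      by (metis imageI)
    then show ?thesis
      by auto
  qed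
  with alt have cofinal: "cofinal_subfamily {M \<in> Fpow K1. c M = 1} (Fpow K1)"
    by (metis order_refl)
  have K1: "suppression_unconditional_on (1 + \<epsilon>) K1 x"
  proof (rule suppression_unconditional_on_finite_subsets)
    fix L assume "finite L" "L \<subseteq> K1"
    then have "L \<in> Fpow K1"
      by (simp add: Fpow_def)
    then obtain M where "L \<subseteq> M" "c M = 1"
      using cofinal unfolding cofinal_subfamily_def by blast
    moreover from this have "suppression_unconditional_on (1 + \<epsilon>) M x"
      by (simp add: c_def split: if_splits)
    ultimately show "suppression_unconditional_on (1 + \<epsilon>) L x"
      using suppression_unconditional_on_subset by blast
  qed (use \<epsilon> in simp)
  \<comment> \<open>Only here does the order of the indices matter: \<open>K1\<close> must be
    thinned to an increasing copy of \<open>\<Lambda>\<close>.\<close>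
  have "Well_order \<kappa>" "Well_order \<Lambda>"
    using assms(1,2) by (simp_all add: cinfinite_def card_order_on_well_order_on)
  then obtain g where g: "strictly_increasing_between \<Lambda> \<kappa> g" "g ` Field \<Lambda> \<subseteq> K1" "inj_on g (Field \<Lambda>)"
    using strictly_increasing_between_card_of[OF _ K(2) _ K(4)] by metis
  then show "\<exists>g. strictly_increasing_between \<Lambda> \<kappa> g \<and>
      suppression_unconditional_on (1 + \<epsilon>) (Field \<Lambda>) (x \<circ> g)"
    using suppression_unconditional_on_subset[OF K1 g(2)]
      suppression_unconditional_on_reindex[OF g(3), of "1 + \<epsilon>" x]
    by (intro exI[of _ g]) simp
qed

end
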